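(* Let a sequence $(\alpha_n)_{n\ge1}$ with $\alpha_n\in\,]0,1[$ be given and let $d_{mn}$ be the associated recursive optimal transport bounds (defined in the context). Then there exist a map $T:C\to C$ on the unit cube $C=[0,1]^{\mathbb N}\subseteq\ell^\infty(\mathbb N)$ that is nonexpansive for $\|\cdot\|_\infty$ (that is, $\|Tx-Ty\|_\infty\le\|x-y\|_\infty$ for all $x,y\in C$) and a point $x^0\in C$ such that the Krasnosel'skii–Mann sequence $x^{n+1}=(1-\alpha_{n+1})x^n+\alpha_{n+1}Tx^n$, $n\ge0$, satisfies $\|x^m-x^n\|_\infty=d_{mn}$ for all $m,n\in\mathbb N$.
   Context: $\mathbb N=\{0,1,2,\dots\}$ and $\mathcal N=\{-1,0,1,2,\dots\}$. $\ell^\infty(\mathbb N)$ is the space of bounded real sequences with the supremum norm $\|\cdot\|_\infty$. Given $(\alpha_n)_{n\ge1}\subseteq\,]0,1[$, set $\alpha_0=1$ and, for $n\in\mathbb N$ and $i=0,\dots,n$, $\pi_i^n=\alpha_i\prod_{k=i+1}^n(1-\alpha_k)$; for each $n$, $(\pi_i^n)_{i=0}^n$ is a probability distribution on $\{0,\dots,n\}$. The numbers $d_{mn}$, $m,n\in\mathcal N$, are defined recursively by $d_{-1,-1}=0$, $d_{-1,k}=d_{k,-1}=1$ for all $k\in\mathbb N$, and for $m,n\in\mathbb N$ $$d_{mn}=\min_{z\in F^{mn}}\ \sum_{i=0}^m\sum_{j=0}^n z_{ij}\,d_{i-1,j-1},$$ where $F^{mn}$ is the set of transport plans from $\pi^m$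 to $\pi^n$, i.e. of all real arrays $z=(z_{ij})_{0\le i\le m,\,0\le j\le n}$ with $z_{ij}\ge0$, $\sum_{j=0}^n z_{ij}=\pi_i^m$ for all $i=0,\dots,m$, and $\sum_{i=0}^m z_{ij}=\pi_j^n$ for all $j=0,\dots,n$. *)

theory Defs
  imports "HOL-Analysis.Analysis"
begin

text \<open>
  The space of bounded real sequences is \<^typ>\<open>nat \<Rightarrow>\<^sub>C real\<close>: the topology of
  \<^typ>\<open>nat\<close> is discrete, so continuity is no restriction, and the norm of this type is
  the supremum norm.
\<close>

definition unit_cube :: "(nat \<Rightarrow>\<^sub>C real) set" where
  "unit_cube = {x. \<forall>i. apply_bcontfun x i \<in> {0..1}}"

text \<open>The value \<open>\<alpha> 0\<close> of the given sequence is ignored; the convention that it is 1 is built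
  into the weights.\<close>

definition km_weight :: "(nat \<Rightarrow> real) \<Rightarrow> nat \<Rightarrow> nat \<Rightarrow> real" where
  "km_weight \<alpha> n i = (if i = 0 then 1 else \<alpha> i) * (\<Prod>k\<in>{i + 1..n}. 1 - \<alpha> k)"

text \<open>Entries outside the index rectangle are unconstrained; no cost below depends on them.\<close>

definition transport_plans :: "(nat \<Rightarrow> real) \<Rightarrow> nat \<Rightarrow> nat \<Rightarrow> (nat \<Rightarrow> nat \<Rightarrow> real) set" where
  "transport_plans \<alpha> m n =
    {z. (\<forall>i\<le>m. \<forall>j\<le>n. z i j \<ge> 0) \<and>
        (\<forall>i\<le>m. (\<Sum>j\<le>n. z i j) = km_weight \<alpha> m i) \<and>
        (\<forall>j\<le>n. (\<Sum>i\<le>m. z i j) = km_weight \<alpha> n j)}"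

text \<open>The indices range over the integers from -1 on; any other negative index is treated like -1.
  The infimum is a minimum, see \<open>ot_bound_attained\<close> and \<open>ot_bound_le\<close>.\<close>

function ot_bound :: "(nat \<Rightarrow> real) \<Rightarrow> int \<Rightarrow> int \<Rightarrow> real" where
  "ot_bound \<alpha> m n =
    (if m < 0 \<and> n < 0 then 0
     else if m < 0 \<or> n < 0 then 1
     else (INF z\<in>transport_plans \<alpha> (nat m) (nat n).
             \<Sum>i\<le>nat m. \<Sum>j\<le>nat n. z i j * ot_bound \<alpha> (int i - 1) (int j - 1)))"
  by pat_completeness auto
termination
  by (relation "Wellfounded.measure (\<lambda>(\<alpha>, m, n). nat (m + 1) + nat (n + 1))") auto

declare ot_bound.simps [simp del]

primrec km_seq :: "(nat \<Rightarrow> real) \<Rightarrow> ('a \<Rightarrow> 'a) \<Rightarrow> 'a \<Rightarrow> nat \<Rightarrow> 'a::real_vector" where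
  "km_seq \<alpha> T x0 0 = x0"
| "km_seq \<alpha> T x0 (Suc n) =
    (1 - \<alpha> (n + 1)) *\<^sub>R km_seq \<alpha> T x0 n + \<alpha> (n + 1) *\<^sub>R T (km_seq \<alpha> T x0 n)"


lemma ot_bound_base:
  "ot_bound \<alpha> (-1) (-1) = 0"
  "ot_bound \<alpha> (-1) (int k) = 1"
  "ot_bound \<alpha> (int k) (-1) = 1"
  by (simp_all add: ot_bound.simps)

lemma ot_bound_rec:
  "ot_bound \<alpha> (int m) (int n) =
    (INF z\<in>transport_plans \<alpha> m n.
       \<Sum>i\<le>m. \<Sum>j\<le>n. z i j * ot_bound \<alpha> (int i - 1) (int j - 1))"
  by (subst ot_bound.simps) simp

context
  fixes \<alpha> :: "nat \<Rightarrow> real"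
  assumes \<alpha>: "\<And>n. n \<ge> 1 \<Longrightarrow> 0 < \<alpha> n \<and> \<alpha> n < 1"
begin

lemma km_weight_nonneg: "km_weight \<alpha> n i \<ge> 0"
proof -
  have "(\<Prod>k\<in>{i + 1..n}. 1 - \<alpha> k) \<ge> 0"
    using \<alpha> by (intro prod_nonneg) (auto simp: less_imp_le)
  moreover have "(if i = 0 then 1 else \<alpha> i) \<ge> 0"
    using \<alpha>[of i] by auto
  ultimately show ?thesis
    unfolding km_weight_def by (rule mult_nonneg_nonneg[rotated])
qed

lemma sum_km_weight: "(\<Sum>i\<le>n. km_weight \<alpha> n i) = 1"
proof (induction n)
  case 0
  show ?case by (simp add: km_weight_def)
next
  case (Suc n)
  have "km_weight \<alpha> (Suc n) i = km_weight \<alpha> n i * (1 - \<alpha> (Suc n))" if "i \<le> n" for i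
    using that by (simp add: km_weight_def prod.nat_ivl_Suc')
  then have "(\<Sum>i\<le>n. km_weight \<alpha> (Suc n) i) = (\<Sum>i\<le>n. km_weight \<alpha> n i) * (1 - \<alpha> (Suc n))"
    by (simp add: sum_distrib_right)
  then show ?case
    using Suc by (simp add: km_weight_def)
qed

lemma transport_plan_attains_min:
  fixes c :: "nat \<Rightarrow> nat \<Rightarrow> real"
  obtains z where "z \<in> transport_plans \<alpha> m n"
    and "\<And>w. w \<in> transport_plans \<alpha> m n \<Longrightarrow>
      (\<Sum>i\<le>m. \<Sum>j\<le>n. z i j * c i j) \<le> (\<Sum>i\<le>m. \<Sum>j\<le>n. w i j * c i j)"
proof -
  define R where "R = {..m} \<times> {..n}"
  define K where "K = (\<Pi>\<^sub>E p\<in>UNIV. if p \<in> R then {0..1::real} else {0})"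
  define S where "S = {f \<in> K. (\<lambda>i j. f (i, j)) \<in> transport_plans \<alpha> m n}"
  define cost where "cost f = (\<Sum>i\<le>m. \<Sum>j\<le>n. f (i, j) * c i j)" for f :: "nat \<times> nat \<Rightarrow> real"
  have coord: "continuous_on UNIV (\<lambda>f :: nat \<times> nat \<Rightarrow> real. f p)" for p
    by (rule continuous_on_product_coordinates)
  have "compactin (product_topology (\<lambda>_. euclidean) UNIV) K"
    unfolding K_def by (subst compactin_PiE) auto
  then have "compact K"
    by (simp add: euclidean_product_topology)
  have "S = K \<inter> (\<Inter>i\<in>{..m}. {f. (\<Sum>j\<le>n. f (i, j)) = km_weight \<alpha> m i})
              \<inter> (\<Inter>j\<in>{..n}. {f. (\<Sum>i\<le>m. f (i, j)) = km_weight \<alpha> n j})"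
  proof -
    have "f (i, j) \<ge> 0" if "f \<in> K" "i \<le> m" "j \<le> n" for f i j
    proof -
      have "f (i, j) \<in> (if (i, j) \<in> R then {0..1} else {0})"
        using that(1) unfolding K_def by blast
      then show ?thesis
        using that by (simp add: R_def)
    qed
    then show ?thesis
      by (auto simp: S_def transport_plans_def)
  qed
  moreover have "closed (\<Inter>i\<in>{..m}. {f :: nat \<times> nat \<Rightarrow> real. (\<Sum>j\<le>n. f (i, j)) = km_weight \<alpha> m i})"
    by (intro closed_INT ballI closed_Collect_eq continuous_on_sum coord continuous_on_const)
  moreover have "closed (\<Inter>j\<in>{..n}. {f :: nat \<times> nat \<Rightarrow> real. (\<Sum>i\<le>m. f (i, j)) = km_weight \<alpha> n j})"
    by (intro closed_INT ballI closed_Collect_eq continuous_on_sum coord continuous_on_const)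
  ultimately have "compact S"
    using \<open>compact K\<close> by (simp add: compact_Int_closed)
  define trunc where "trunc z = (\<lambda>(i, j). if (i, j) \<in> R then z i j else 0)"
    for z :: "nat \<Rightarrow> nat \<Rightarrow> real"
  have trunc_S: "trunc z \<in> S" if z: "z \<in> transport_plans \<alpha> m n" for z
  proof -
    have "z i j \<le> 1" if "i \<le> m" "j \<le> n" for i j
    proof -
      have "z i j \<le> (\<Sum>j\<le>n. z i j)"
        using z that by (intro member_le_sum) (auto simp: transport_plans_def)
      also have "\<dots> = km_weight \<alpha> m i"
        using z that by (auto simp: transport_plans_def)
      also have "\<dots> \<le> (\<Sum>i\<le>m. km_weight \<alpha> m i)"
        using that by (intro member_le_sum) (auto simp: km_weight_nonneg)
      finally show ?thesis by (simp add: sum_km_weight)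
    qed
    then show ?thesis
      using z by (auto simp: S_def K_def trunc_def R_def transport_plans_def PiE_iff)
  qed
  have cost_trunc: "cost (trunc z) = (\<Sum>i\<le>m. \<Sum>j\<le>n. z i j * c i j)" for z
    by (auto simp: cost_def trunc_def R_def)
  have "(\<lambda>i j. km_weight \<alpha> m i * km_weight \<alpha> n j) \<in> transport_plans \<alpha> m n"
    by (auto simp: transport_plans_def km_weight_nonneg sum_km_weight
        simp flip: sum_distrib_left sum_distrib_right)
  then have "S \<noteq> {}"
    using trunc_S by blast
  moreover have "continuous_on S cost"
    unfolding cost_def
    by (intro continuous_on_sum continuous_on_mult continuous_on_const
        continuous_on_subset[OF coord]) auto
  ultimately obtain f where f: "f \<in> S" "\<And>g. g \<in> S \<Longrightarrow> cost f \<le> cost g"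
    using continuous_attains_inf[OF \<open>compact S\<close>] by blast
  show thesis
  proof (rule that[of "\<lambda>i j. f (i, j)"])
    show "(\<lambda>i j. f (i, j)) \<in> transport_plans \<alpha> m n"
      using f(1) by (simp add: S_def)
    fix w assume "w \<in> transport_plans \<alpha> m n"
    from f(2)[OF trunc_S[OF this]]
    show "(\<Sum>i\<le>m. \<Sum>j\<le>n. f (i, j) * c i j) \<le> (\<Sum>i\<le>m. \<Sum>j\<le>n. w i j * c i j)"
      by (simp only: cost_trunc) (simp add: cost_def)
  qed
qed

lemma ot_bound_attained:
  "\<exists>z\<in>transport_plans \<alpha> m n. ot_bound \<alpha> (int m) (int n) =
    (\<Sum>i\<le>m. \<Sum>j\<le>n. z i j * ot_bound \<alpha> (int i - 1) (int j - 1))"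
proof -
  let ?cost = "\<lambda>z. \<Sum>i\<le>m. \<Sum>j\<le>n. z i j * ot_bound \<alpha> (int i - 1) (int j - 1)"
  obtain z where z: "z \<in> transport_plans \<alpha> m n"
    and le: "\<And>w. w \<in> transport_plans \<alpha> m n \<Longrightarrow> ?cost z \<le> ?cost w"
    by (rule transport_plan_attains_min[where c = "\<lambda>i j. ot_bound \<alpha> (int i - 1) (int j - 1)"])
      (rule that)
  have "Inf (?cost ` transport_plans \<alpha> m n) = ?cost z"
    by (rule cInf_eq_minimum) (use z le in blast)+
  then show ?thesis
    using z by (subst ot_bound_rec) (rule bexI)
qed

lemma ot_bound_le:
  assumes "z \<in> transport_plans \<alpha> m n"
  shows "ot_bound \<alpha> (int m) (int n)
    \<le> (\<Sum>i\<le>m. \<Sum>j\<le>n. z i j * ot_bound \<alpha> (int i - 1) (int j - 1))"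
proof -
  let ?cost = "\<lambda>z. \<Sum>i\<le>m. \<Sum>j\<le>n. z i j * ot_bound \<alpha> (int i - 1) (int j - 1)"
  obtain z0 where "\<And>w. w \<in> transport_plans \<alpha> m n \<Longrightarrow> ?cost z0 \<le> ?cost w"
    by (rule transport_plan_attains_min[where c = "\<lambda>i j. ot_bound \<alpha> (int i - 1) (int j - 1)"])
      (rule that)
  then have "bdd_below (?cost ` transport_plans \<alpha> m n)"
    by (rule bdd_belowI2)
  then have "(INF z\<in>transport_plans \<alpha> m n. ?cost z) \<le> ?cost z"
    using assms by (rule cINF_lower)
  then show ?thesis
    by (simp only: ot_bound_rec)
qed

end

end

theory Submission
  imports Defs
begin

text \<open>
  With \<open>y 0 = x 0\<close> and \<open>y (i + 1) = T (x i)\<close>, the iterates are \<open>x n = (\<Sum>i\<le>n. \<pi>\<^sup>n\<^sub>i y i)\<close>, so it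
  suffices to choose the points \<open>y i\<close> of the cube and then extend \<open>T\<close> from the orbit, one
  coordinate at a time. By induction the bounds form a pseudometric; hence, by linear programming
  duality, the transport cost \<open>d\<^sub>m\<^sub>n\<close> is attained by a single potential that is 1-Lipschitz for the
  costs \<open>d\<^sub>i\<^sub>-\<^sub>1\<^sub>,\<^sub>j\<^sub>-\<^sub>1\<close>. Using these potentials, one for each pair \<open>(m, n)\<close>, as the coordinates of the
  \<open>y i\<close>, weak duality bounds every coordinate of \<open>x m - x n\<close> by \<open>d\<^sub>m\<^sub>n\<close>, and coordinate \<open>(m, n)\<close>
  attains it.
\<close>

section \<open>Linear programming duality\<close>

text \<open>Induction on the generators of the cone. A functional \<open>y\<close> separating
  \<open>b\<close> from the smaller cone either works for the new generator too, or serves to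
  project it away, which leaves a problem over the old index set.\<close>

lemma farkas:
  fixes A :: "'k \<Rightarrow> 'i \<Rightarrow> real" and b :: "'i \<Rightarrow> real"
  assumes "finite K" "finite I"
  shows "(\<exists>c. (\<forall>k\<in>K. 0 \<le> c k) \<and> (\<forall>i\<in>I. b i = (\<Sum>k\<in>K. c k * A k i))) \<or>
    (\<exists>x. (\<forall>k\<in>K. (\<Sum>i\<in>I. A k i * x i) \<le> 0) \<and> 0 < (\<Sum>i\<in>I. b i * x i))"
  using assms(1)
proof (induction K arbitrary: A b rule: finite_induct)
  case empty
  show ?case
  proof (cases "\<forall>i\<in>I. b i = 0")
    case False
    then obtain i where "i \<in> I" "b i \<noteq> 0" by blast
    then have "0 < (\<Sum>i\<in>I. b i * b i)"
      using assms(2) by (intro sum_pos2[of I i]) (auto simp: zero_less_mult_iff linorder_neq_iff)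
    then show ?thesis by auto
  qed simp
next
  case (insert l K)
  have lin: "(\<Sum>i\<in>I. (f i - s * g i) * (x i - t * y i)) =
      (\<Sum>i\<in>I. f i * x i) - t * (\<Sum>i\<in>I. f i * y i)
      - s * (\<Sum>i\<in>I. g i * x i) + s * t * (\<Sum>i\<in>I. g i * y i)"
    for f g x y :: "'i \<Rightarrow> real" and s t
    by (simp add: sum_distrib_left sum.distrib sum_subtractf algebra_simps)
  from insert.IH[of b A] show ?case
  proof (elim disjE exE conjE)
    fix c assume c: "\<forall>k\<in>K. 0 \<le> c k" "\<forall>i\<in>I. b i = (\<Sum>k\<in>K. c k * A k i)"
    have "(\<Sum>k\<in>K. (c(l := 0)) k * A k i) = (\<Sum>k\<in>K. c k * A k i)" for i
      using insert.hyps by (intro sum.cong) auto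
    with c insert.hyps show ?thesis
      by (intro disjI1 exI[of _ "c(l := 0)"]) auto
  next
    fix y assume y: "\<forall>k\<in>K. (\<Sum>i\<in>I. A k i * y i) \<le> 0" "0 < (\<Sum>i\<in>I. b i * y i)"
    define r where "r = (\<Sum>i\<in>I. A l i * y i)"
    show ?thesis
    proof (cases "r \<le> 0")
      case True
      with y show ?thesis by (auto simp: r_def)
    next
      case False
      define p where "p f = (\<Sum>i\<in>I. f i * y i) / r" for f
      \<comment> \<open>Project along \<open>y\<close> onto the hyperplane on which the new functional vanishes.\<close>
      from insert.IH[of "\<lambda>i. b i - p b * A l i" "\<lambda>k i. A k i - p (A k) * A l i"]
      show ?thesis
      proof (elim disjE exE conjE)
        fix c assume c: "\<forall>k\<in>K. 0 \<le> c k"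
          "\<forall>i\<in>I. b i - p b * A l i = (\<Sum>k\<in>K. c k * (A k i - p (A k) * A l i))"
        \<comment> \<open>Lifting the projected combination back, \<open>d\<close> is the
          coefficient of \<open>A l\<close>. It is nonnegative because \<open>y\<close> is positive
          on \<open>b\<close> and nonpositive on the old generators.\<close>
        define d where "d = p b - (\<Sum>k\<in>K. c k * p (A k))"
        have "(\<Sum>k\<in>K. c k * p (A k)) \<le> 0"
          using c y False by (intro sum_nonpos) (auto simp: p_def mult_nonneg_nonpos divide_nonpos_pos)
        moreover have "p b \<ge> 0"
          using y False by (simp add: p_def)
        ultimately have d: "d \<ge> 0"
          by (simp add: d_def)
        have eq: "(\<Sum>k\<in>K. (c(l := d)) k * A k i) = (\<Sum>k\<in>K. c k * A k i)" for i
          using insert.hyps by (intro sum.cong) auto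
        have "b i = (\<Sum>k\<in>insert l K. (c(l := d)) k * A k i)" if "i \<in> I" for i
        proof -
          have "b i = p b * A l i + (\<Sum>k\<in>K. c k * (A k i - p (A k) * A l i))"
            using c(2) that by (metis add.commute diff_add_cancel)
          also have "\<dots> = d * A l i + (\<Sum>k\<in>K. c k * A k i)"
            by (simp add: d_def algebra_simps sum_subtractf sum_distrib_left)
          finally show ?thesis
            using insert.hyps eq by simp
        qed
        with c d show ?thesis
          by (intro disjI1 exI[of _ "c(l := d)"]) auto
      next
        fix x assume x: "\<forall>k\<in>K. (\<Sum>i\<in>I. (A k i - p (A k) * A l i) * x i) \<le> 0"
          "0 < (\<Sum>i\<in>I. (b i - p b * A l i) * x i)"
        \<comment> \<open>This \<open>s\<close> makes \<open>A l\<close> vanish at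
          \<open>x - s y\<close>; evaluating any \<open>f\<close> there equals evaluating its
          projection at \<open>x\<close>.\<close>
        define s where "s = (\<Sum>i\<in>I. A l i * x i) / r"
        have "(\<Sum>i\<in>I. f i * (x i - s * y i)) = (\<Sum>i\<in>I. (f i - p f * A l i) * x i)" for f
          using lin[of f 0 f x s y] lin[of f "p f" "A l" x 0 y] False
          by (simp add: p_def s_def r_def)
        moreover have "(\<Sum>i\<in>I. A l i * (x i - s * y i)) = 0"
          using lin[of "A l" 0 "A l" x s y] False
          by (simp add: s_def r_def)
        ultimately show ?thesis
          using x by (intro disjI2 exI[of _ "\<lambda>i. x i - s * y i"]) auto
      qed
    qed
  qed
qed

text \<open>Farkas' lemma for the homogenized dual system: an obstruction to potentials of value at
  least \<open>C\<close> would yield a plan cheaper than \<open>C\<close>.\<close>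

lemma transport_duality:
  fixes c :: "'a \<Rightarrow> 'b \<Rightarrow> real"
  assumes fin: "finite A" "finite B"
    and bound: "\<And>z. (\<And>i j. i \<in> A \<Longrightarrow> j \<in> B \<Longrightarrow> 0 \<le> z i j) \<Longrightarrow>
      (\<And>i. i \<in> A \<Longrightarrow> (\<Sum>j\<in>B. z i j) = \<mu> i) \<Longrightarrow>
      (\<And>j. j \<in> B \<Longrightarrow> (\<Sum>i\<in>A. z i j) = \<nu> j) \<Longrightarrow>
      C \<le> (\<Sum>i\<in>A. \<Sum>j\<in>B. z i j * c i j)"
  shows "\<exists>u v. (\<forall>i\<in>A. \<forall>j\<in>B. u i + v j \<le> c i j) \<and>
    C \<le> (\<Sum>i\<in>A. \<mu> i * u i) + (\<Sum>j\<in>B. \<nu> j * v j)"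
proof -
  \<comment> \<open>The unknowns are \<open>u\<close>, \<open>v\<close> and a homogenizing variable \<open>t > 0\<close>, indexed by \<open>None\<close>.\<close>
  define I where "I = insert None (Some ` (A <+> B))"
  define K where "K = insert None (Some ` (A \<times> B))"
  \<comment> \<open>Row \<open>None\<close> encodes \<open>C t \<le> \<mu> u + \<nu> v\<close>, row
    \<open>Some (i, j)\<close> encodes \<open>u i + v j \<le> t c i j\<close>, and \<open>b\<close>
    reads off \<open>t\<close>.\<close>
  define M :: "('a \<times> 'b) option \<Rightarrow> ('a + 'b) option \<Rightarrow> real" where
    "M k l = (case k of
        None \<Rightarrow> (case l of None \<Rightarrow> C | Some (Inl i) \<Rightarrow> - \<mu> i | Some (Inr j) \<Rightarrow> - \<nu> j)
      | Some (i, j) \<Rightarrow> (case l of None \<Rightarrow> - c i j | Some (Inl i') \<Rightarrow> of_bool (i = i')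
          | Some (Inr j') \<Rightarrow> of_bool (j = j')))" for k l
  define b :: "('a + 'b) option \<Rightarrow> real" where "b l = of_bool (l = None)" for l
  have sumI: "sum f I = f None + (\<Sum>i\<in>A. f (Some (Inl i))) + (\<Sum>j\<in>B. f (Some (Inr j)))"
    for f :: "_ \<Rightarrow> real"
    using fin by (simp add: I_def sum.reindex sum.Plus o_def add.assoc)
  have sumK: "sum f K = f None + (\<Sum>i\<in>A. \<Sum>j\<in>B. f (Some (i, j)))" for f :: "_ \<Rightarrow> real"
    using fin by (simp add: K_def sum.reindex o_def sum.cartesian_product)
  have "finite K" "finite I"
    using fin by (auto simp: I_def K_def)
  have mem: "i \<in> A \<Longrightarrow> Some (Inl i) \<in> I" "j \<in> B \<Longrightarrow> Some (Inr j) \<in> I" "None \<in> I" for i j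
    by (auto simp: I_def)
  from farkas[OF \<open>finite K\<close> \<open>finite I\<close>, of b M] show ?thesis
  proof (elim disjE exE conjE)
    fix w assume w: "\<forall>k\<in>K. 0 \<le> w k" "\<forall>l\<in>I. b l = (\<Sum>k\<in>K. w k * M k l)"
    define z where "z i j = w (Some (i, j))" for i j
    define s where "s = w None"
    have z: "0 \<le> z i j" if "i \<in> A" "j \<in> B" for i j
      using w(1) that by (auto simp: z_def K_def)
    have s: "0 \<le> s"
      using w(1) by (auto simp: s_def K_def)
    have row: "(\<Sum>j\<in>B. z i j) = s * \<mu> i" if "i \<in> A" for i
    proof -
      have "b (Some (Inl i)) = (\<Sum>k\<in>K. w k * M k (Some (Inl i)))"
        using w(2) mem(1)[OF that] by blast
      also have "\<dots> = - s * \<mu> i + (\<Sum>i'\<in>A. \<Sum>j\<in>B. if i' = i then z i' j else 0)"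
        by (simp add: sumK M_def s_def z_def of_bool_def if_distrib cong: if_cong)
      also have "(\<Sum>i'\<in>A. \<Sum>j\<in>B. if i' = i then z i' j else 0) = (\<Sum>j\<in>B. z i j)"
        using that fin by (subst sum.swap) simp
      finally show ?thesis by (simp add: b_def)
    qed
    have col: "(\<Sum>i\<in>A. z i j) = s * \<nu> j" if "j \<in> B" for j
    proof -
      have "b (Some (Inr j)) = (\<Sum>k\<in>K. w k * M k (Some (Inr j)))"
        using w(2) mem(2)[OF that] by blast
      also have "\<dots> = - s * \<nu> j + (\<Sum>i\<in>A. \<Sum>j'\<in>B. if j' = j then z i j' else 0)"
        by (simp add: sumK M_def s_def z_def of_bool_def if_distrib cong: if_cong)
      also have "(\<Sum>i\<in>A. \<Sum>j'\<in>B. if j' = j then z i j' else 0) = (\<Sum>i\<in>A. z i j)"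
        using that fin by simp
      finally show ?thesis by (simp add: b_def)
    qed
    have "b None = (\<Sum>k\<in>K. w k * M k None)"
      using w(2) mem(3) by blast
    then have cost: "(\<Sum>i\<in>A. \<Sum>j\<in>B. z i j * c i j) = s * C - 1"
      by (simp add: sumK M_def s_def z_def b_def sum_negf)
    \<comment> \<open>For \<open>s = 0\<close> the marginals force \<open>z = 0\<close>,
      contradicting cost \<open>-1\<close>; otherwise \<open>z / s\<close> is a plan of cost
      \<open>C - 1 / s\<close>.\<close>
    have False
    proof (cases "s = 0")
      case True
      then have "z i j = 0" if "i \<in> A" "j \<in> B" for i j
        using row[of i] that z fin by (simp add: sum_nonneg_eq_0_iff)
      then show False
        using cost True by simp
    next
      case False
      have "C \<le> (\<Sum>i\<in>A. \<Sum>j\<in>B. z i j / s * c i j)"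
        using z s row col False by (intro bound) (auto simp flip: sum_divide_distrib)
      also have "\<dots> = (\<Sum>i\<in>A. \<Sum>j\<in>B. z i j * c i j) / s"
        by (simp add: sum_divide_distrib)
      also have "\<dots> < C"
        using cost False s by (simp add: field_simps)
      finally show False by simp
    qed
    then show ?thesis ..
  next
    fix x assume x: "\<forall>k\<in>K. (\<Sum>l\<in>I. M k l * x l) \<le> 0" "0 < (\<Sum>l\<in>I. b l * x l)"
    define t where "t = x None"
    have t: "t > 0"
      using x(2) by (simp add: sumI b_def t_def)
    define u where "u i = x (Some (Inl i)) / t" for i
    define v where "v j = x (Some (Inr j)) / t" for j
    have "u i + v j \<le> c i j" if "i \<in> A" "j \<in> B" for i j
    proof -
      have "(\<Sum>l\<in>I. M (Some (i, j)) l * x l) \<le> 0"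
        using x(1) that by (simp add: K_def)
      then have "x (Some (Inl i)) + x (Some (Inr j)) \<le> t * c i j"
        using that fin by (simp add: sumI M_def t_def of_bool_def if_distrib
            if_distribR mult.commute cong: if_cong)
      then show ?thesis
        using t by (simp add: u_def v_def field_simps)
    qed
    moreover have "C \<le> (\<Sum>i\<in>A. \<mu> i * u i) + (\<Sum>j\<in>B. \<nu> j * v j)"
    proof -
      have "(\<Sum>l\<in>I. M None l * x l) \<le> 0"
        using x(1) by (simp add: K_def)
      then have "C * t \<le> (\<Sum>i\<in>A. \<mu> i * x (Some (Inl i))) + (\<Sum>j\<in>B. \<nu> j * x (Some (Inr j)))"
        by (simp add: sumI M_def t_def sum_negf)
      then show ?thesis
        using t by (simp add: u_def v_def pos_le_divide_eq flip: sum_divide_distrib add_divide_distrib)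
    qed
    ultimately show ?thesis by blast
  qed
qed

section \<open>Lipschitz extension\<close>

text \<open>The infimal convolution \<open>h\<close> of \<open>f\<close> with the distance is
  1-Lipschitz, and \<open>lip\<close> makes it agree with \<open>f\<close> at the points
  \<open>x k\<close>. Cutting it off at 1 preserves both, since \<open>f \<le> 1\<close>.\<close>

lemma mcshane_extension:
  fixes f :: "'i \<Rightarrow> real" and x :: "'i \<Rightarrow> 'a::metric_space"
  assumes f: "\<And>k. f k \<in> {0..1}" and lip: "\<And>k l. f k - f l \<le> dist (x k) (x l)"
  shows "\<exists>g. (\<forall>a. g a \<in> {0..1}) \<and> (\<forall>a b. \<bar>g a - g b\<bar> \<le> dist a b) \<and> (\<forall>k. g (x k) = f k)"
proof -
  define h where "h a = (INF k. f k + dist a (x k))" for a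
  have nonneg: "0 \<le> f k + dist a (x k)" for k a
    using f[of k] by simp
  have bdd: "bdd_below (range (\<lambda>k. f k + dist a (x k)))" for a
    using nonneg by (intro bdd_belowI2[of _ 0]) auto
  have le: "h a \<le> f k + dist a (x k)" for a k
    unfolding h_def using bdd by (intro cINF_lower) auto
  have h_lip: "h a \<le> h b + dist a b" for a b
  proof -
    have "h a - dist a b \<le> f k + dist b (x k)" for k
      using le[of a k] dist_triangle[of a "x k" b] by simp
    then have "h a - dist a b \<le> h b"
      unfolding h_def[of b] by (intro cINF_greatest) auto
    then show ?thesis by simp
  qed
  have h0: "0 \<le> h a" for a
    unfolding h_def using nonneg by (intro cINF_greatest) auto
  have hx: "h (x k) = f k" for k
  proof (rule antisym)
    show "h (x k) \<le> f k"
      using le[of "x k" k] by simp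
    show "f k \<le> h (x k)"
      unfolding h_def using lip[of k] by (intro cINF_greatest) (auto simp: algebra_simps)
  qed
  have "\<bar>min 1 (h a) - min 1 (h b)\<bar> \<le> dist a b" for a b
    using h_lip[of a b] h_lip[of b a] by (auto simp: dist_commute)
  then show ?thesis
    using h0 hx f by (intro exI[of _ "\<lambda>a. min 1 (h a)"]) auto
qed

section \<open>Range, symmetry and zero diagonal of the bounds\<close>

text \<open>The shift lets naturals replace -1, 0, 1, ...: index 0 will stand for the starting
  point, index \<open>i + 1\<close> for the image of the \<open>i\<close>-th iterate.\<close>

definition ot_cost :: "(nat \<Rightarrow> real) \<Rightarrow> nat \<Rightarrow> nat \<Rightarrow> real" where
  "ot_cost \<alpha> i j = ot_bound \<alpha> (int i - 1) (int j - 1)"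

lemma ot_cost_simps [simp]:
  "ot_cost \<alpha> 0 0 = 0" "ot_cost \<alpha> 0 (Suc n) = 1" "ot_cost \<alpha> (Suc m) 0 = 1"
  "ot_cost \<alpha> (Suc m) (Suc n) = ot_bound \<alpha> (int m) (int n)"
  by (simp_all add: ot_cost_def ot_bound_base)

text \<open>Through these recursions the weighted averages of the \<open>y i\<close> obey the
  Krasnosel'skii-Mann iteration.\<close>

lemma km_weight_Suc:
  "i \<le> n \<Longrightarrow> km_weight \<alpha> (Suc n) i = (1 - \<alpha> (Suc n)) * km_weight \<alpha> n i"
  "km_weight \<alpha> (Suc n) (Suc n) = \<alpha> (Suc n)"
  by (simp_all add: km_weight_def prod.nat_ivl_Suc')

locale km_steps =
  fixes \<alpha> :: "nat \<Rightarrow> real"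
  assumes step: "\<And>n. n \<ge> 1 \<Longrightarrow> 0 < \<alpha> n \<and> \<alpha> n < 1"
begin

lemma weight_nonneg: "0 \<le> km_weight \<alpha> n i"
  by (rule km_weight_nonneg) (rule step)

lemma sum_weight: "(\<Sum>i\<le>n. km_weight \<alpha> n i) = 1"
  by (rule sum_km_weight) (rule step)

lemma ot_bound_eq_cost:
  obtains z where "z \<in> transport_plans \<alpha> m n"
    "ot_bound \<alpha> (int m) (int n) = (\<Sum>i\<le>m. \<Sum>j\<le>n. z i j * ot_cost \<alpha> i j)"
proof -
  have "\<exists>z\<in>transport_plans \<alpha> m n. ot_bound \<alpha> (int m) (int n) =
      (\<Sum>i\<le>m. \<Sum>j\<le>n. z i j * ot_cost \<alpha> i j)"
    unfolding ot_cost_def by (rule ot_bound_attained) (rule step)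
  then show thesis
    using that by blast
qed

lemma ot_bound_le_cost:
  "z \<in> transport_plans \<alpha> m n \<Longrightarrow>
    ot_bound \<alpha> (int m) (int n) \<le> (\<Sum>i\<le>m. \<Sum>j\<le>n. z i j * ot_cost \<alpha> i j)"
  unfolding ot_cost_def by (rule ot_bound_le) (rule step)

lemma transport_plan_total:
  assumes "z \<in> transport_plans \<alpha> m n"
  shows "(\<Sum>i\<le>m. \<Sum>j\<le>n. z i j) = 1"
  using assms sum_weight[of m] by (simp add: transport_plans_def)

text \<open>At successors the cost is an average of costs at smaller indices, since an optimal plan
  has total mass 1.\<close>

lemma ot_cost_range: "ot_cost \<alpha> i j \<in> {0..1}"
proof (induction "i + j" arbitrary: i j rule: less_induct)
  case less
  show ?case
  proof (cases i; cases j)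
    fix m n assume ij: "i = Suc m" "j = Suc n"
    obtain z where z: "z \<in> transport_plans \<alpha> m n"
      and eq: "ot_bound \<alpha> (int m) (int n) = (\<Sum>i\<le>m. \<Sum>j\<le>n. z i j * ot_cost \<alpha> i j)"
      by (rule ot_bound_eq_cost)
    have IH: "ot_cost \<alpha> k l \<in> {0..1}" if "k \<le> m" "l \<le> n" for k l
      using less that by (simp add: ij)
    have z0: "0 \<le> z k l" if "k \<le> m" "l \<le> n" for k l
      using z that by (auto simp: transport_plans_def)
    have "0 \<le> (\<Sum>i\<le>m. \<Sum>j\<le>n. z i j * ot_cost \<alpha> i j)"
      using IH z0 by (intro sum_nonneg mult_nonneg_nonneg) auto
    moreover have "(\<Sum>i\<le>m. \<Sum>j\<le>n. z i j * ot_cost \<alpha> i j) \<le> (\<Sum>i\<le>m. \<Sum>j\<le>n. z i j)"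
      using IH z0 by (intro sum_mono mult_right_le_one_le) auto
    ultimately show ?thesis
      using eq transport_plan_total[OF z] by (simp add: ij)
  qed auto
qed

text \<open>Transposing an optimal plan gives a competitor for the swapped pair.\<close>

lemma ot_cost_sym: "ot_cost \<alpha> i j = ot_cost \<alpha> j i"
proof -
  have "ot_cost \<alpha> i j \<le> ot_cost \<alpha> j i" for i j
  proof (induction "i + j" arbitrary: i j rule: less_induct)
    case less
    show ?case
    proof (cases i; cases j)
      fix m n assume ij: "i = Suc m" "j = Suc n"
      obtain z where z: "z \<in> transport_plans \<alpha> n m"
        and eq: "ot_bound \<alpha> (int n) (int m) = (\<Sum>i\<le>n. \<Sum>j\<le>m. z i j * ot_cost \<alpha> i j)"
        by (rule ot_bound_eq_cost)
      have "(\<lambda>i j. z j i) \<in> transport_plans \<alpha> m n"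
        using z by (auto simp: transport_plans_def)
      then have "ot_bound \<alpha> (int m) (int n) \<le> (\<Sum>i\<le>m. \<Sum>j\<le>n. z j i * ot_cost \<alpha> i j)"
        by (rule ot_bound_le_cost)
      also have "\<dots> \<le> (\<Sum>i\<le>m. \<Sum>j\<le>n. z j i * ot_cost \<alpha> j i)"
        using less z by (intro sum_mono mult_left_mono) (auto simp: ij transport_plans_def)
      also have "\<dots> = ot_bound \<alpha> (int n) (int m)"
        unfolding eq by (rule sum.swap)
      finally show ?thesis by (simp add: ij)
    qed auto
  qed
  then show ?thesis by (intro antisym)
qed

text \<open>The plan that leaves all mass in place pays only diagonal costs, which vanish by
  induction.\<close>

lemma ot_cost_refl: "ot_cost \<alpha> i i = 0"
proof (induction i rule: less_induct)
  case (less i)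
  show ?case
  proof (cases i)
    case (Suc m)
    have "(\<lambda>i j. if i = j then km_weight \<alpha> m i else 0) \<in> transport_plans \<alpha> m m"
      using weight_nonneg by (auto simp: transport_plans_def)
    from ot_bound_le_cost[OF this]
    have "ot_bound \<alpha> (int m) (int m) \<le> (\<Sum>i\<le>m. km_weight \<alpha> m i * ot_cost \<alpha> i i)"
      by (simp add: if_distrib if_distribR cong: if_cong)
    also have "\<dots> = 0"
      using less Suc by simp
    finally show ?thesis
      using ot_cost_range[of i i] Suc by simp
  qed simp
qed

section \<open>Potentials and the triangle inequality\<close>

text \<open>Sum the Lipschitz inequality against an optimal plan; its marginals produce the two
  averages.\<close>

lemma weak_duality:
  assumes "\<And>i j. i \<le> m \<Longrightarrow> j \<le> n \<Longrightarrow> w i - w j \<le> ot_cost \<alpha> i j"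
  shows "(\<Sum>i\<le>m. km_weight \<alpha> m i * w i) - (\<Sum>j\<le>n. km_weight \<alpha> n j * w j)
    \<le> ot_bound \<alpha> (int m) (int n)"
proof -
  obtain z where z: "z \<in> transport_plans \<alpha> m n"
    and eq: "ot_bound \<alpha> (int m) (int n) = (\<Sum>i\<le>m. \<Sum>j\<le>n. z i j * ot_cost \<alpha> i j)"
    by (rule ot_bound_eq_cost)
  have "(\<Sum>i\<le>m. km_weight \<alpha> m i * w i) = (\<Sum>i\<le>m. \<Sum>j\<le>n. z i j * w i)"
    using z by (simp add: transport_plans_def flip: sum_distrib_right)
  moreover have "(\<Sum>j\<le>n. km_weight \<alpha> n j * w j) = (\<Sum>i\<le>m. \<Sum>j\<le>n. z i j * w j)"
    using z by (subst sum.swap) (simp add: transport_plans_def flip: sum_distrib_right)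
  ultimately have "(\<Sum>i\<le>m. km_weight \<alpha> m i * w i) - (\<Sum>j\<le>n. km_weight \<alpha> n j * w j)
      = (\<Sum>i\<le>m. \<Sum>j\<le>n. z i j * (w i - w j))"
    by (simp add: sum_subtractf right_diff_distrib)
  also have "\<dots> \<le> (\<Sum>i\<le>m. \<Sum>j\<le>n. z i j * ot_cost \<alpha> i j)"
    using z assms by (intro sum_mono mult_left_mono) (auto simp: transport_plans_def)
  finally show ?thesis
    by (simp only: eq)
qed

text \<open>The set \<open>S\<close> allows use inside the induction for the triangle inequality,
  which is then known only for indices up to \<open>N\<close>; later \<open>S\<close> is
  \<open>UNIV\<close>.\<close>

lemma lipschitz_potential:
  assumes sub: "{..m} \<subseteq> S" "{..n} \<subseteq> S"
    and triangle: "\<And>i j k. i \<in> S \<Longrightarrow> j \<in> S \<Longrightarrow> k \<in> S \<Longrightarrow>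
      ot_cost \<alpha> i k \<le> ot_cost \<alpha> i j + ot_cost \<alpha> j k"
  obtains w where "\<And>i j. i \<in> S \<Longrightarrow> j \<in> S \<Longrightarrow> w i - w j \<le> ot_cost \<alpha> i j"
    and "ot_bound \<alpha> (int m) (int n)
      \<le> (\<Sum>i\<le>m. km_weight \<alpha> m i * w i) - (\<Sum>j\<le>n. km_weight \<alpha> n j * w j)"
proof -
  have "\<exists>u v. (\<forall>i\<in>{..m}. \<forall>j\<in>{..n}. u i + v j \<le> ot_cost \<alpha> i j) \<and>
    ot_bound \<alpha> (int m) (int n)
      \<le> (\<Sum>i\<le>m. km_weight \<alpha> m i * u i) + (\<Sum>j\<le>n. km_weight \<alpha> n j * v j)"
    by (intro transport_duality ot_bound_le_cost) (auto simp: transport_plans_def)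
  then obtain u v where uv: "\<And>i j. i \<le> m \<Longrightarrow> j \<le> n \<Longrightarrow> u i + v j \<le> ot_cost \<alpha> i j"
    and val: "ot_bound \<alpha> (int m) (int n)
      \<le> (\<Sum>i\<le>m. km_weight \<alpha> m i * u i) + (\<Sum>j\<le>n. km_weight \<alpha> n j * v j)"
    by auto
  \<comment> \<open>The c-transform of \<open>v\<close> merges both potentials into one that is Lipschitz on all of \<open>S\<close>.\<close>
  define w where "w i = Min ((\<lambda>j. ot_cost \<alpha> i j - v j) ` {..n})" for i
  have w_le: "w i \<le> ot_cost \<alpha> i j - v j" if "j \<le> n" for i j
    using that by (auto simp: w_def)
  have w_ge: "x \<le> w i" if "\<And>j. j \<le> n \<Longrightarrow> x \<le> ot_cost \<alpha> i j - v j" for i x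
    using that by (auto simp: w_def)
  show thesis
  proof (rule that)
    fix i k assume ik: "i \<in> S" "k \<in> S"
    have "w i - ot_cost \<alpha> i k \<le> w k"
    proof (rule w_ge)
      fix j assume "j \<le> n"
      then show "w i - ot_cost \<alpha> i k \<le> ot_cost \<alpha> k j - v j"
        using w_le[of j i] triangle[of i k j] ik sub by auto
    qed
    then show "w i - w k \<le> ot_cost \<alpha> i k" by simp
  next
    \<comment> \<open>Passing from \<open>(u, v)\<close> to \<open>(w, -w)\<close> does not lower
      the dual value: \<open>u \<le> w\<close> by feasibility, and \<open>v \<le> -w\<close> because
      the cost vanishes on the diagonal.\<close>
    have "(\<Sum>i\<le>m. km_weight \<alpha> m i * u i) \<le> (\<Sum>i\<le>m. km_weight \<alpha> m i * w i)"
    proof (intro sum_mono mult_left_mono w_ge)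
      fix i j assume "i \<in> {..m}" "j \<le> n"
      then show "u i \<le> ot_cost \<alpha> i j - v j"
        using uv[of i j] by simp
    qed (simp add: weight_nonneg)
    moreover have "(\<Sum>j\<le>n. km_weight \<alpha> n j * v j) \<le> (\<Sum>j\<le>n. km_weight \<alpha> n j * - w j)"
    proof (intro sum_mono mult_left_mono)
      fix j assume "j \<in> {..n}"
      then show "v j \<le> - w j"
        using w_le[of j j] ot_cost_refl[of j] by simp
    qed (simp add: weight_nonneg)
    ultimately show "ot_bound \<alpha> (int m) (int n)
      \<le> (\<Sum>i\<le>m. km_weight \<alpha> m i * w i) - (\<Sum>j\<le>n. km_weight \<alpha> n j * w j)"
      using val by (simp add: sum_negf)
  qed
qed

text \<open>Induction on a bound \<open>N\<close> for the indices. For positive indices, a potential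
  optimal for the outer pair is feasible for both inner pairs, and the average at the middle index
  cancels.\<close>

lemma ot_cost_triangle: "ot_cost \<alpha> i k \<le> ot_cost \<alpha> i j + ot_cost \<alpha> j k"
proof -
  have "\<forall>i\<le>N. \<forall>j\<le>N. \<forall>k\<le>N. ot_cost \<alpha> i k \<le> ot_cost \<alpha> i j + ot_cost \<alpha> j k" for N
  proof (induction N)
    case (Suc N)
    have range: "0 \<le> ot_cost \<alpha> i j" "ot_cost \<alpha> i j \<le> 1" for i j
      using ot_cost_range[of i j] by auto
    have "ot_cost \<alpha> i k \<le> ot_cost \<alpha> i j + ot_cost \<alpha> j k"
      if ijk: "i \<le> Suc N" "j \<le> Suc N" "k \<le> Suc N" for i j k
    proof (cases "i = 0 \<or> j = 0 \<or> k = 0")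
      \<comment> \<open>Costs involving index 0 are 0 or 1, so the range of the remaining costs
        suffices.\<close>
      case True
      then show ?thesis
        using range[of i k] range[of i j] range[of j k]
        by (cases i; cases j; cases k) auto
    next
      case False
      then obtain l m n where eqs: "i = Suc l" "j = Suc m" "k = Suc n"
        by (metis not0_implies_Suc)
      obtain w where lip: "\<And>i j. i \<in> {..N} \<Longrightarrow> j \<in> {..N} \<Longrightarrow> w i - w j \<le> ot_cost \<alpha> i j"
        and val: "ot_bound \<alpha> (int l) (int n)
          \<le> (\<Sum>i\<le>l. km_weight \<alpha> l i * w i) - (\<Sum>j\<le>n. km_weight \<alpha> n j * w j)"
        by (rule lipschitz_potential[of l "{..N}" n]) (use Suc.IH ijk eqs in auto)
      have "(\<Sum>i\<le>l. km_weight \<alpha> l i * w i) - (\<Sum>j\<le>m. km_weight \<alpha> m j * w j)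
          \<le> ot_bound \<alpha> (int l) (int m)"
        "(\<Sum>i\<le>m. km_weight \<alpha> m i * w i) - (\<Sum>j\<le>n. km_weight \<alpha> n j * w j)
          \<le> ot_bound \<alpha> (int m) (int n)"
        using lip ijk eqs by (auto intro!: weak_duality)
      with val show ?thesis
        by (simp add: eqs)
    qed
    then show ?case by blast
  qed simp
  from this[of "max i (max j k)"] show ?thesis by simp
qed

text \<open>Subtract the infimum: costs at most 1 bound the oscillation, and the constant cancels
  because both weights sum to 1. The Lipschitz bound at all indices makes the coordinate respect
  every other pair as well.\<close>

lemma unit_potential:
  obtains w where "\<And>i. w i \<in> {0..1}" and "\<And>i j. w i - w j \<le> ot_cost \<alpha> i j"
    and "ot_bound \<alpha> (int m) (int n)
      \<le> (\<Sum>i\<le>m. km_weight \<alpha> m i * w i) - (\<Sum>j\<le>n. km_weight \<alpha> n j * w j)"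
proof -
  obtain w where lip: "\<And>i j. w i - w j \<le> ot_cost \<alpha> i j"
    and val: "ot_bound \<alpha> (int m) (int n)
      \<le> (\<Sum>i\<le>m. km_weight \<alpha> m i * w i) - (\<Sum>j\<le>n. km_weight \<alpha> n j * w j)"
    by (rule lipschitz_potential[of m UNIV n]) (auto simp: ot_cost_triangle)
  have osc: "w i - 1 \<le> w j" for i j
    using lip[of i j] ot_cost_range[of i j] by simp
  define a where "a = (INF i. w i)"
  have "a \<le> w i" for i
    unfolding a_def using osc[of 0] by (intro cINF_lower bdd_belowI2[of _ "w 0 - 1"]) auto
  moreover have "w i - 1 \<le> a" for i
    unfolding a_def using osc by (intro cINF_greatest) auto
  ultimately have "w i - a \<in> {0..1}" for i
    by (simp add: algebra_simps)
  moreover have "(\<Sum>i\<le>m. km_weight \<alpha> m i * (w i - a)) = (\<Sum>i\<le>m. km_weight \<alpha> m i * w i) - a" for m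
    by (simp add: right_diff_distrib sum_subtractf sum_weight flip: sum_distrib_right)
  ultimately show thesis
    using lip val by (intro that[of "\<lambda>i. w i - a"]) auto
qed

end

section \<open>Construction of the orbit and of the map\<close>

lemma apply_Bcontfun:
  fixes f :: "nat \<Rightarrow> real"
  assumes "\<And>i. f i \<in> {0..1}"
  shows "apply_bcontfun (Bcontfun f) = f"
  using assms by (intro Bcontfun_inverse bcontfun_normI[of _ 1]) auto

theorem theorem2p4:
  fixes \<alpha> :: "nat \<Rightarrow> real"
  assumes "\<And>n. n \<ge> 1 \<Longrightarrow> 0 < \<alpha> n \<and> \<alpha> n < 1"
  shows "\<exists>(T :: (nat \<Rightarrow>\<^sub>C real) \<Rightarrow> (nat \<Rightarrow>\<^sub>C real)) x0.
    T \<in> unit_cube \<rightarrow> unit_cube \<and>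
    (\<forall>x\<in>unit_cube. \<forall>y\<in>unit_cube. norm (T x - T y) \<le> norm (x - y)) \<and>
    x0 \<in> unit_cube \<and>
    (\<forall>m n. norm (km_seq \<alpha> T x0 m - km_seq \<alpha> T x0 n) = ot_bound \<alpha> (int m) (int n))"
proof -
  interpret km_steps \<alpha>
    by unfold_locales (rule assms)
  have "\<exists>w. (\<forall>i. w i \<in> {0..1}) \<and> (\<forall>i j. w i - w j \<le> ot_cost \<alpha> i j) \<and>
      ot_bound \<alpha> (int m) (int n)
        \<le> (\<Sum>i\<le>m. km_weight \<alpha> m i * w i) - (\<Sum>j\<le>n. km_weight \<alpha> n j * w j)" for m n
    by (rule unit_potential[of m n]) blast+
  then obtain W where W: "\<And>m n i. W m n i \<in> {0..1::real}"
      "\<And>m n i j. W m n i - W m n j \<le> ot_cost \<alpha> i j"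
      "\<And>m n. ot_bound \<alpha> (int m) (int n)
        \<le> (\<Sum>i\<le>m. km_weight \<alpha> m i * W m n i) - (\<Sum>j\<le>n. km_weight \<alpha> n j * W m n j)"
    by metis
  \<comment> \<open>Coordinate \<open>p\<close> of \<open>y i\<close> belongs to the pair \<open>(m, n)\<close> encoded by \<open>p\<close>;
    \<open>y (Suc k)\<close> will be the image under \<open>T\<close> of \<open>x k\<close>.\<close>
  define Y where "Y i p = W (fst (prod_decode p)) (snd (prod_decode p)) i" for i p
  define y where "y i = Bcontfun (Y i)" for i
  define x where "x n = (\<Sum>i\<le>n. km_weight \<alpha> n i *\<^sub>R y i)" for n
  have Y: "Y i p \<in> {0..1}" "Y i p - Y j p \<le> ot_cost \<alpha> i j" for i j p
    unfolding Y_def by (fact W)+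
  have y: "apply_bcontfun (y i) = Y i" for i
    unfolding y_def using Y(1) by (rule apply_Bcontfun)
  have apply_sum: "apply_bcontfun (\<Sum>i\<in>A. c i *\<^sub>R y i) p = (\<Sum>i\<in>A. c i * Y i p)" for A c p
    by (induction A rule: infinite_finite_induct) (auto simp: y)
  have x: "apply_bcontfun (x n) p = (\<Sum>i\<le>n. km_weight \<alpha> n i * Y i p)" for n p
    unfolding x_def by (rule apply_sum)
  have x_dist: "norm (x m - x n) = ot_bound \<alpha> (int m) (int n)" for m n
  proof (rule antisym)
    have le: "apply_bcontfun (x m - x n) p \<le> ot_bound \<alpha> (int m) (int n)" for m n p
      using weak_duality[of m n "\<lambda>i. Y i p"] Y(2) by (simp add: x)
    \<comment> \<open>Negative values are controlled by the swapped pair, whose bound is the same by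
      symmetry.\<close>
    have "\<bar>apply_bcontfun (x m - x n) p\<bar> \<le> ot_bound \<alpha> (int m) (int n)" for p
      using le[of m n p] le[of n m p] ot_cost_sym[of "Suc m" "Suc n"] by auto
    then show "norm (x m - x n) \<le> ot_bound \<alpha> (int m) (int n)"
      by (intro norm_bound) simp
    have "ot_bound \<alpha> (int m) (int n) \<le> apply_bcontfun (x m - x n) (prod_encode (m, n))"
      using W(3)[of m n] by (simp add: x Y_def)
    also have "\<dots> \<le> norm (x m - x n)"
      using norm_bounded[of "x m - x n" "prod_encode (m, n)"] by simp
    finally show "ot_bound \<alpha> (int m) (int n) \<le> norm (x m - x n)" .
  qed
  \<comment> \<open>The index shift pays off: \<open>Y (Suc k) p - Y (Suc l) p\<close> is at most
    \<open>ot_cost \<alpha> (Suc k) (Suc l)\<close>, which is exactly the distance of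
    \<open>x k\<close> and \<open>x l\<close>.\<close>
  have "\<exists>g. (\<forall>a. g a \<in> {0..1}) \<and> (\<forall>a b. \<bar>g a - g b\<bar> \<le> dist a b) \<and> (\<forall>k. g (x k) = Y (Suc k) p)" for p
    by (rule mcshane_extension) (use Y[of _ p] Y(2)[of "Suc _" p "Suc _"] in \<open>auto simp: dist_norm x_dist\<close>)
  then obtain G where G: "\<And>p a. G p a \<in> {0..1}" "\<And>p a b. \<bar>G p a - G p b\<bar> \<le> dist a b"
    "\<And>p k. G p (x k) = Y (Suc k) p"
    by metis
  define T where "T a = Bcontfun (\<lambda>p. G p a)" for a
  have T: "apply_bcontfun (T a) p = G p a" for a p
    unfolding T_def using G(1) by (subst apply_Bcontfun) auto
  have Tx: "T (x k) = y (Suc k)" for k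
    by (rule bcontfun_eqI) (simp add: T y G(3))
  have km: "km_seq \<alpha> T (x 0) n = x n" for n
  proof (induction n)
    case (Suc n)
    have "x (Suc n) = (1 - \<alpha> (Suc n)) *\<^sub>R x n + \<alpha> (Suc n) *\<^sub>R y (Suc n)"
      by (simp add: x_def km_weight_Suc scaleR_sum_right)
    then show ?case
      by (simp add: Suc Tx)
  qed simp
  have "x 0 = y 0"
    by (simp add: x_def km_weight_def)
  then have "x 0 \<in> unit_cube"
    using Y(1) by (simp add: unit_cube_def y)
  moreover have "T \<in> unit_cube \<rightarrow> unit_cube"
    using G(1) by (simp add: unit_cube_def T)
  \<comment> \<open>In the supremum norm the bounds on single coordinates combine.\<close>
  moreover have "norm (T a - T b) \<le> norm (a - b)" for a b
    using G(2) by (intro norm_bound) (simp add: T dist_norm)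
  ultimately show ?thesis
    by (intro exI[of _ T] exI[of _ "x 0"]) (simp add: km x_dist)
qed

end
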